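(* Let $I\subset[0,\infty)$ be an interval, let $[\alpha,\beta]\subset I$ with $\alpha<\beta$, and let $G:[\alpha,\beta]\to\mathbb{R}$ be a twice differentiable function on $[\alpha,\beta]$ (derivatives at the endpoints $\alpha,\beta$ being one-sided). Let $q\geq 1$ and $\eta:\mathbb{R}\times\mathbb{R}\to\mathbb{R}$. Suppose that $|G''|^q$ is $\eta$-quasiconvex on $[\alpha,\beta]$ and that $\eta$ is bounded from above on $|G''|^q([\alpha,\beta])\times|G''|^q([\alpha,\beta])$. Then for every $\lambda\in[0,1]$, $$\left|\frac{1}{\beta-\alpha}\int_\alpha^\beta G(x)\,dx-(1-\lambda)G\left(\frac{\alpha+\beta}{2}\right)-\lambda\frac{G(\alpha)+G(\beta)}{2}\right|\leq\begin{cases}\dfrac{(\beta-\alpha)^2}{16}\left(\dfrac{8\lambda^3-3\lambda+1}{3}\right)\left(\mathcal{N}_{q,\eta}^{1/q}+\mathcal{M}_{q,\eta}^{1/q}\right), & \text{if } 0\leq\lambda\leq\frac12,\\[2mm] \dfrac{(\beta-\alpha)^2}{16}\left(\lambda-\dfrac13\right)\left(\mathcal{N}_{q,\eta}^{1/q}+\mathcal{M}_{q,\eta}^{1/q}\right), & \text{if } \frac12\leq\lambda\leq1,\end{cases}$$ where $$\mathcal{M}_{q,\eta}:=\max\left\{|G''(\alpha)|^q,\ |G''(\alpha)|^q+\eta\left(\left|G''\left(\tfrac{\alpha+\beta}{2}\right)\right|^q,|G''(\alpha)|^q\right)\right\}$$ and $$\mathcal{N}_{q,\eta}:=\max\left\{|G''(\beta)|^q,\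 |G''(\beta)|^q+\eta\left(\left|G''\left(\tfrac{\alpha+\beta}{2}\right)\right|^q,|G''(\beta)|^q\right)\right\}.$$
   Context: Given $\eta:\mathbb{R}\times\mathbb{R}\to\mathbb{R}$ and an interval $J\subset\mathbb{R}$, a function $F:J\to\mathbb{R}$ is called $\eta$-quasiconvex (with respect to $\eta$) on $J$ if $F(xu+(1-x)v)\leq\max\{F(v),\,F(v)+\eta(F(u),F(v))\}$ for all $u,v\in J$ and $x\in[0,1]$. *)

theory Defs
  imports "HOL-Analysis.Analysis"
begin

definition eta_quasiconvex_on :: "(real \<Rightarrow> real \<Rightarrow> real) \<Rightarrow> real set \<Rightarrow> (real \<Rightarrow> real) \<Rightarrow> bool" where
  "eta_quasiconvex_on \<eta> J F \<longleftrightarrow>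
     is_interval J \<and>
     (\<forall>u\<in>J. \<forall>v\<in>J. \<forall>x\<in>{0..1}.
        F (x * u + (1 - x) * v) \<le> max (F v) (F v + \<eta> (F u) (F v)))"

text \<open>In the next two definitions the argument \<open>D\<close> stands for the second derivative of the
  function under consideration.\<close>

definition cal_M :: "real \<Rightarrow> (real \<Rightarrow> real \<Rightarrow> real) \<Rightarrow> (real \<Rightarrow> real) \<Rightarrow> real \<Rightarrow> real \<Rightarrow> real" where
  "cal_M q \<eta> D \<alpha> \<beta> =
     max (\<bar>D \<alpha>\<bar> powr q)
         (\<bar>D \<alpha>\<bar> powr q + \<eta> (\<bar>D ((\<alpha> + \<beta>) / 2)\<bar> powr q) (\<bar>D \<alpha>\<bar> powr q))"

definition cal_N :: "real \<Rightarrow> (real \<Rightarrow> real \<Rightarrow> real) \<Rightarrow> (real \<Rightarrow> real) \<Rightarrow> real \<Rightarrow> real \<Rightarrow> real" where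
  "cal_N q \<eta> D \<alpha> \<beta> =
     max (\<bar>D \<beta>\<bar> powr q)
         (\<bar>D \<beta>\<bar> powr q + \<eta> (\<bar>D ((\<alpha> + \<beta>) / 2)\<bar> powr q) (\<bar>D \<beta>\<bar> powr q))"

end

theory Submission
  imports Defs
begin

text \<open>
  Write \<open>m\<close> for the midpoint and \<open>h\<close> for half the length of \<open>[\<alpha>, \<beta>]\<close>. Measuring the distance
  \<open>t \<in> [0, h]\<close> from the nearer endpoint, integrate by parts twice on each half against the Peano
  kernel \<open>k t = t\<^sup>2 / 2 - lam * h * t\<close>. Since \<open>k'' = 1\<close>, this produces the integral of \<open>G\<close>; since
  \<open>k 0 = 0\<close>, \<open>k' 0 = - lam * h\<close> and \<open>k' h = (1 - lam) * h\<close>, the boundary terms are the weighted values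
  of \<open>G\<close> at the endpoint and at the midpoint, and a multiple of \<open>G' m\<close>. The two halves run in
  opposite directions, so the terms with \<open>G' m\<close> cancel, and \<open>\<beta> - \<alpha>\<close> times the quadrature error is
  left as the sum of two integrals of \<open>k\<close> times the second derivative; bounding each half
  separately gives \<open>peano_kernel_estimate\<close>.

  Quasiconvexity, applied between an endpoint and the midpoint, bounds \<open>\<bar>G''\<bar>\<close> by
  \<open>cal_M powr (1/q)\<close> on the left half and by \<open>cal_N powr (1/q)\<close> on the right half
  (\<open>eta_quasiconvex_half_bound\<close>). What remains is the integral of \<open>\<bar>k\<bar>\<close>: the kernel vanishes at
  \<open>2 * lam * h\<close>, which lies inside \<open>[0, h]\<close> exactly when \<open>lam \<le> 1/2\<close>, whence the two cases.

  The second derivative may be discontinuous. The integral of \<open>k * G''\<close> nevertheless exists, because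
  \<open>k * G''\<close> is a derivative plus a continuous function.
\<close>

text \<open>
  Two integrations by parts amount to one application of the fundamental theorem of calculus to
  \<open>k * f' - k' * f\<close>, whose derivative is \<open>k * f'' - f\<close>. The free end \<open>h\<close> contributes \<open>k h * f' h\<close> with
  \<open>k h = (1/2 - lam) * h\<^sup>2\<close>; it is kept inside the absolute value because it has to cancel against
  the other half.
\<close>

lemma peano_kernel_half:
  fixes f f' f'' :: "real \<Rightarrow> real"
  assumes h: "0 \<le> h"
    and f: "\<And>t. t \<in> {0..h} \<Longrightarrow> (f has_real_derivative f' t) (at t within {0..h})"
    and f': "\<And>t. t \<in> {0..h} \<Longrightarrow> (f' has_real_derivative f'' t) (at t within {0..h})"
    and C: "\<And>t. t \<in> {0..h} \<Longrightarrow> \<bar>f'' t\<bar> \<le> C"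
    and w: "((\<lambda>t. \<bar>t^2 / 2 - lam * h * t\<bar>) has_integral w) {0..h}"
  shows "\<bar>integral {0..h} f - (1 - lam) * h * f h - lam * h * f 0
           + (1/2 - lam) * h^2 * f' h\<bar> \<le> w * C"
proof -
  define k where "k t = t^2 / 2 - lam * h * t" for t
  have k: "(k has_real_derivative t - lam * h) (at t within {0..h})" for t
    unfolding k_def by (auto intro!: derivative_eq_intros)
  have cont: "continuous_on {0..h} f"
    using f by (meson DERIV_continuous continuous_on_eq_continuous_within)
  have "((\<lambda>t. k t * f' t - (t - lam * h) * f t) has_real_derivative k t * f'' t - f t)
          (at t within {0..h})" if "t \<in> {0..h}" for t
    by (rule derivative_eq_intros k f[OF that] f'[OF that] refl)+ (simp add: algebra_simps)
  then have "((\<lambda>t. k t * f'' t - f t) has_integral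
      (k h * f' h - (h - lam * h) * f h) - (k 0 * f' 0 - (0 - lam * h) * f 0)) {0..h}"
    using h by (intro fundamental_theorem_of_calculus)
      (auto simp: has_real_derivative_iff_has_vector_derivative)
  from has_integral_add[OF this integrable_integral[OF integrable_continuous_real[OF cont]]]
  have kf: "((\<lambda>t. k t * f'' t) has_integral
      integral {0..h} f - (1 - lam) * h * f h - lam * h * f 0 + (1/2 - lam) * h^2 * f' h) {0..h}"
    by (simp add: k_def algebra_simps power2_eq_square)
  have wC: "((\<lambda>t. \<bar>k t\<bar> * C) has_integral w * C) {0..h}"
    using has_integral_mult_left[OF w, of C] by (simp add: k_def)
  have "norm (integral {0..h} (\<lambda>t. k t * f'' t)) \<le> integral {0..h} (\<lambda>t. \<bar>k t\<bar> * C)"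
    using kf wC C by (intro integral_norm_bound_integral)
      (auto simp: abs_mult has_integral_integrable intro!: mult_left_mono)
  then show ?thesis
    unfolding integral_unique[OF kf] integral_unique[OF wC] real_norm_def .
qed

text \<open>
  The substitution \<open>x = p + s * t\<close> with \<open>s = 1\<close> or \<open>s = -1\<close> carries the estimate to either half of an
  interval, with \<open>p\<close> the outer endpoint. The factor \<open>s\<close> in front of the derivative at the far end is
  what makes the two halves cancel.
\<close>

lemma peano_kernel_half_affine:
  fixes G G' G'' :: "real \<Rightarrow> real"
  assumes h: "0 \<le> h" and s: "s = 1 \<or> s = -1"
    and S: "S = (\<lambda>t. p + s * t) ` {0..h}"
    and G: "\<And>x. x \<in> S \<Longrightarrow> (G has_real_derivative G' x) (at x within S)"
    and G': "\<And>x. x \<in> S \<Longrightarrow> (G' has_real_derivative G'' x) (at x within S)"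
    and C: "\<And>x. x \<in> S \<Longrightarrow> \<bar>G'' x\<bar> \<le> C"
    and w: "((\<lambda>t. \<bar>t^2 / 2 - lam * h * t\<bar>) has_integral w) {0..h}"
  shows "\<bar>integral S G - (1 - lam) * h * G (p + s * h) - lam * h * G p
           + (1/2 - lam) * h^2 * (s * G' (p + s * h))\<bar> \<le> w * C"
proof -
  have aff: "((\<lambda>t. p + s * t) has_real_derivative s) (at t within {0..h})" for t
    by (auto intro!: derivative_eq_intros)
  have ss: "s * (y * s) = y" for y using s by auto
  have f: "((\<lambda>t. G (p + s * t)) has_real_derivative s * G' (p + s * t)) (at t within {0..h})"
    if "t \<in> {0..h}" for t
    using DERIV_image_chain[OF G[unfolded S] aff, of t, OF imageI[OF that]]
    by (simp add: o_def mult.commute[of "G' (p + s * t)" s])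
  have f': "((\<lambda>t. s * G' (p + s * t)) has_real_derivative G'' (p + s * t)) (at t within {0..h})"
    if "t \<in> {0..h}" for t
    using DERIV_cmult[OF DERIV_image_chain[OF G'[unfolded S] aff, of t, OF imageI[OF that]], of s] that
    by (simp add: o_def ss)
  have C': "\<bar>G'' (p + s * t)\<bar> \<le> C" if "t \<in> {0..h}" for t
    by (rule C) (use that in \<open>auto simp: S\<close>)
  define a b where "a = min p (p + s * h)" and "b = max p (p + s * h)"
  have ab: "S = {a..b}"
    using s h by (auto simp: S a_def b_def image_affinity_atLeastAtMost)
  have "(G has_integral integral S G) (cbox a b)"
    unfolding ab cbox_interval
    by (rule integrable_integral[OF integrable_continuous_real])
      (metis G DERIV_continuous ab continuous_on_eq_continuous_within)
  from has_integral_affinity[OF this, of s p]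
  have "((\<lambda>t. G (p + s * t)) has_integral integral S G) ((\<lambda>x. (x - p) / s) ` S)"
    using s by (auto simp: ab add.commute diff_divide_distrib)
  moreover have "(\<lambda>x. (x - p) / s) ` S = {0..h}"
    using s by (auto simp: S image_image)
  ultimately have "integral {0..h} (\<lambda>t. G (p + s * t)) = integral S G"
    by (simp add: integral_unique)
  with peano_kernel_half[OF h f f' C' w] show ?thesis by simp
qed

lemma peano_kernel_estimate:
  fixes G G' G'' :: "real \<Rightarrow> real"
  assumes h: "0 \<le> h"
    and G: "\<And>x. x \<in> {m - h..m + h} \<Longrightarrow> (G has_real_derivative G' x) (at x within {m - h..m + h})"
    and G': "\<And>x. x \<in> {m - h..m + h} \<Longrightarrow> (G' has_real_derivative G'' x) (at x within {m - h..m + h})"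
    and M: "\<And>x. x \<in> {m - h..m} \<Longrightarrow> \<bar>G'' x\<bar> \<le> M"
    and N: "\<And>x. x \<in> {m..m + h} \<Longrightarrow> \<bar>G'' x\<bar> \<le> N"
    and w: "((\<lambda>t. \<bar>t^2 / 2 - lam * h * t\<bar>) has_integral w) {0..h}"
  shows "\<bar>integral {m - h..m + h} G - (1 - lam) * (2 * h) * G m
           - lam * h * (G (m - h) + G (m + h))\<bar> \<le> w * (N + M)"
proof -
  have img: "{m - h..m} = (\<lambda>t. (m - h) + 1 * t) ` {0..h}"
    "{m..m + h} = (\<lambda>t. (m + h) + (-1) * t) ` {0..h}"
    using h by (simp_all add: image_affinity_atLeastAtMost)
  have left: "\<bar>integral {m - h..m} G - (1 - lam) * h * G m - lam * h * G (m - h)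
           + (1/2 - lam) * h^2 * G' m\<bar> \<le> w * M"
    using peano_kernel_half_affine[OF h _ img(1) DERIV_subset[OF G] DERIV_subset[OF G'] M w] h
    by simp
  have right: "\<bar>integral {m..m + h} G - (1 - lam) * h * G m - lam * h * G (m + h)
           - (1/2 - lam) * h^2 * G' m\<bar> \<le> w * N"
    using peano_kernel_half_affine[OF h _ img(2) DERIV_subset[OF G] DERIV_subset[OF G'] N w] h
    by simp
  have "continuous_on {m - h..m + h} G"
    using G by (meson DERIV_continuous continuous_on_eq_continuous_within)
  then have "integral {m - h..m} G + integral {m..m + h} G = integral {m - h..m + h} G"
    using h by (intro Henstock_Kurzweil_Integration.integral_combine integrable_continuous_real) auto
  then show ?thesis
    using left right by (simp add: algebra_simps abs_le_iff)
qed

lemma kernel_antiderivative: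
  fixes a b c :: real
  assumes "a \<le> b"
  shows "((\<lambda>t. t^2 / 2 - c * t) has_integral (b^3 / 6 - c * b^2 / 2) - (a^3 / 6 - c * a^2 / 2)) {a..b}"
  using assms
  by (intro fundamental_theorem_of_calculus)
    (auto simp: has_real_derivative_iff_has_vector_derivative[symmetric] power2_eq_square
      intro!: derivative_eq_intros)

lemma abs_kernel_nonpos_integral:
  fixes c h :: real
  assumes "0 \<le> h" and "h \<le> 2 * c"
  shows "((\<lambda>t. \<bar>t^2 / 2 - c * t\<bar>) has_integral c * h^2 / 2 - h^3 / 6) {0..h}"
proof -
  have "((\<lambda>t. - (t^2 / 2 - c * t)) has_integral c * h^2 / 2 - h^3 / 6) {0..h}"
    using has_integral_neg[OF kernel_antiderivative[OF assms(1), of c]] by simp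
  moreover have "- (t^2 / 2 - c * t) = \<bar>t^2 / 2 - c * t\<bar>" if "t \<in> {0..h}" for t
  proof -
    have "t * (t - 2 * c) \<le> 0" using that assms by (intro mult_nonneg_nonpos) auto
    then show ?thesis by (simp add: power2_eq_square algebra_simps)
  qed
  ultimately show ?thesis by (rule has_integral_eq[rotated])
qed

lemma abs_kernel_sign_change_integral:
  fixes c h :: real
  assumes "0 \<le> c" and "2 * c \<le> h"
  shows "((\<lambda>t. \<bar>t^2 / 2 - c * t\<bar>) has_integral h^3 / 6 - c * h^2 / 2 + 4 * c^3 / 3) {0..h}"
proof -
  have "((\<lambda>t. \<bar>t^2 / 2 - c * t\<bar>) has_integral
      (h^3 / 6 - c * h^2 / 2) - ((2 * c)^3 / 6 - c * (2 * c)^2 / 2)) {2 * c..h}"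
  proof (rule has_integral_eq[OF _ kernel_antiderivative[OF assms(2)]])
    fix t assume "t \<in> {2 * c..h}"
    then have "0 \<le> t * (t - 2 * c)" using assms by (intro mult_nonneg_nonneg) auto
    then show "t^2 / 2 - c * t = \<bar>t^2 / 2 - c * t\<bar>" by (simp add: power2_eq_square algebra_simps)
  qed
  from has_integral_combine[OF _ assms(2) abs_kernel_nonpos_integral this] assms
  show ?thesis by (simp add: power2_eq_square power3_eq_cube algebra_simps)
qed

text \<open>
  Quasiconvexity is not symmetric in its two points: the endpoint \<open>v\<close> is the base point, whose value
  is corrected by \<open>\<eta>\<close>, and \<open>u\<close> is the midpoint in the application.
\<close>

lemma eta_quasiconvex_half_bound:
  fixes D :: "real \<Rightarrow> real"
  assumes qc: "eta_quasiconvex_on \<eta> J (\<lambda>x. \<bar>D x\<bar> powr q)" and q: "q \<ge> 1"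
    and uv: "u \<in> J" "v \<in> J" and x: "x \<in> closed_segment v u"
  shows "\<bar>D x\<bar> \<le> max (\<bar>D v\<bar> powr q) (\<bar>D v\<bar> powr q + \<eta> (\<bar>D u\<bar> powr q) (\<bar>D v\<bar> powr q)) powr (1 / q)"
    (is "_ \<le> ?B powr _")
proof -
  obtain t where t: "t \<in> {0..1}" "x = t * u + (1 - t) * v"
    using x by (auto simp: closed_segment_def add.commute)
  have "\<bar>D x\<bar> powr q \<le> ?B"
    using qc uv t unfolding eta_quasiconvex_on_def by blast
  then have "(\<bar>D x\<bar> powr q) powr (1 / q) \<le> ?B powr (1 / q)"
    using q by (intro powr_mono2) auto
  then show ?thesis
    using q by (simp add: powr_powr)
qed

theorem theorem7:
  fixes I :: "real set" and \<alpha> \<beta> q :: real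
    and G G' G'' :: "real \<Rightarrow> real"
    and \<eta> :: "real \<Rightarrow> real \<Rightarrow> real"
  assumes "is_interval I" and "I \<subseteq> {0..}"
    and "{\<alpha>..\<beta>} \<subseteq> I" and "\<alpha> < \<beta>"
    and "\<And>x. x \<in> {\<alpha>..\<beta>} \<Longrightarrow> (G has_real_derivative G' x) (at x within {\<alpha>..\<beta>})"
    and "\<And>x. x \<in> {\<alpha>..\<beta>} \<Longrightarrow> (G' has_real_derivative G'' x) (at x within {\<alpha>..\<beta>})"
    and "q \<ge> 1"
    and "eta_quasiconvex_on \<eta> {\<alpha>..\<beta>} (\<lambda>x. \<bar>G'' x\<bar> powr q)"
    and "bdd_above ((\<lambda>(s, t). \<eta> s t) `
           (((\<lambda>x. \<bar>G'' x\<bar> powr q) ` {\<alpha>..\<beta>}) \<times> ((\<lambda>x. \<bar>G'' x\<bar> powr q) ` {\<alpha>..\<beta>})))"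
  shows "\<forall>lam\<in>{0..1}.
    (0 \<le> lam \<and> lam \<le> 1/2 \<longrightarrow>
      \<bar>1 / (\<beta> - \<alpha>) * integral {\<alpha>..\<beta>} G - (1 - lam) * G ((\<alpha> + \<beta>) / 2)
          - lam * ((G \<alpha> + G \<beta>) / 2)\<bar>
        \<le> (\<beta> - \<alpha>)^2 / 16 * ((8 * lam^3 - 3 * lam + 1) / 3)
            * (cal_N q \<eta> G'' \<alpha> \<beta> powr (1 / q) + cal_M q \<eta> G'' \<alpha> \<beta> powr (1 / q))) \<and>
    (1/2 \<le> lam \<and> lam \<le> 1 \<longrightarrow>
      \<bar>1 / (\<beta> - \<alpha>) * integral {\<alpha>..\<beta>} G - (1 - lam) * G ((\<alpha> + \<beta>) / 2)
          - lam * ((G \<alpha> + G \<beta>) / 2)\<bar>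
        \<le> (\<beta> - \<alpha>)^2 / 16 * (lam - 1/3)
            * (cal_N q \<eta> G'' \<alpha> \<beta> powr (1 / q) + cal_M q \<eta> G'' \<alpha> \<beta> powr (1 / q)))"
proof -
  define m h where "m = (\<alpha> + \<beta>) / 2" and "h = (\<beta> - \<alpha>) / 2"
  have ends: "\<alpha> = m - h" "\<beta> = m + h" and h: "h > 0"
    using \<open>\<alpha> < \<beta>\<close> by (auto simp: m_def h_def field_simps)
  define M N where "M = cal_M q \<eta> G'' \<alpha> \<beta> powr (1 / q)" and "N = cal_N q \<eta> G'' \<alpha> \<beta> powr (1 / q)"
  have mem: "m \<in> {\<alpha>..\<beta>}" "\<alpha> \<in> {\<alpha>..\<beta>}" "\<beta> \<in> {\<alpha>..\<beta>}"
    using h by (auto simp: ends)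
  have M: "\<bar>G'' x\<bar> \<le> M" if "x \<in> {m - h..m}" for x
    using eta_quasiconvex_half_bound[OF assms(8,7) mem(1,2), of x] that h
    by (simp add: M_def cal_M_def closed_segment_eq_real_ivl flip: m_def) (simp add: ends)
  have N: "\<bar>G'' x\<bar> \<le> N" if "x \<in> {m..m + h}" for x
    using eta_quasiconvex_half_bound[OF assms(8,7) mem(1,3), of x] that h
    by (simp add: N_def cal_N_def closed_segment_eq_real_ivl flip: m_def) (simp add: ends)
  define E where "E lam = 1 / (\<beta> - \<alpha>) * integral {\<alpha>..\<beta>} G - (1 - lam) * G ((\<alpha> + \<beta>) / 2)
          - lam * ((G \<alpha> + G \<beta>) / 2)" for lam
  \<comment> \<open>The kernel estimate bounds \<open>(\<beta> - \<alpha>) * E lam\<close>; the integral of the kernel scales like \<open>h\<^sup>3\<close>,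
      and \<open>h\<^sup>2 / 4\<close> is
      \<open>(\<beta> - \<alpha>)\<^sup>2 / 16\<close>.\<close>
  have bound: "\<bar>E lam\<bar> \<le> (\<beta> - \<alpha>)^2 / 16 * W * (N + M)"
    if W: "((\<lambda>t. \<bar>t^2 / 2 - lam * h * t\<bar>) has_integral W * h^3 / 2) {0..h}" for lam W
  proof -
    have eq: "integral {m - h..m + h} G - (1 - lam) * (2 * h) * G m
           - lam * h * (G (m - h) + G (m + h)) = 2 * h * E lam"
      using h by (simp add: E_def ends field_simps)
    have "2 * h * \<bar>E lam\<bar> \<le> W * h^3 / 2 * (N + M)"
      using peano_kernel_estimate[OF _ assms(5,6)[unfolded ends] M N W] h
      unfolding eq by (simp add: abs_mult)
    also have "\<dots> = 2 * h * ((\<beta> - \<alpha>)^2 / 16 * W * (N + M))"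
      by (simp add: ends power2_eq_square power3_eq_cube)
    finally show ?thesis using h by (simp only: mult_le_cancel_left_pos)
  qed
  have low: "\<bar>E lam\<bar> \<le> (\<beta> - \<alpha>)^2 / 16 * ((8 * lam^3 - 3 * lam + 1) / 3) * (N + M)"
    if "0 \<le> lam" "lam \<le> 1/2" for lam
  proof (rule bound)
    show "((\<lambda>t. \<bar>t^2 / 2 - lam * h * t\<bar>) has_integral (8 * lam^3 - 3 * lam + 1) / 3 * h^3 / 2) {0..h}"
      using abs_kernel_sign_change_integral[of "lam * h" h] that h
      by (simp add: power2_eq_square power3_eq_cube field_simps)
  qed
  have high: "\<bar>E lam\<bar> \<le> (\<beta> - \<alpha>)^2 / 16 * (lam - 1/3) * (N + M)" if "1/2 \<le> lam" for lam
  proof (rule bound)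
    show "((\<lambda>t. \<bar>t^2 / 2 - lam * h * t\<bar>) has_integral (lam - 1/3) * h^3 / 2) {0..h}"
      using abs_kernel_nonpos_integral[of h "lam * h"] that h
      by (simp add: power2_eq_square power3_eq_cube field_simps)
  qed
  show ?thesis
    using low high unfolding E_def M_def N_def by blast
qed

end
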